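(* Let $\varphi$ be a hyperbolic linear-fractional self-map of $\mathbb{D}$ with a fixed point $\zeta\in\partial\mathbb{D}$. If $\varphi$ can be written as $\varphi(z)=a_0+\frac{a_1z}{1-a_0z}$ with $a_0\in\mathbb{D}$ and $a_1\in\mathbb{C}$, then $\varphi$ is an automorphism of $\mathbb{D}$.
   Context: $\mathbb{D}$ is the open unit disk. A linear-fractional self-map $\varphi$ of $\mathbb{D}$ (not the identity) with a fixed point on $\partial\mathbb{D}$ is called hyperbolic if it has two distinct fixed points in the Riemann sphere (one on $\partial\mathbb{D}$; the other may lie in $\mathbb{D}$, outside the closed disk, or, when $\varphi$ is an automorphism, on $\partial\mathbb{D}$). *)

theory Defs
  imports "HOL-Complex_Analysis.Complex_Analysis"
begin

abbreviation unit_disc :: "complex set" where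
  "unit_disc \<equiv> ball 0 1"

text \<open>The Riemann sphere is \<^typ>\<open>complex option\<close>, with \<^term>\<open>None\<close> as the point at infinity.\<close>

definition moebius_map :: "complex \<Rightarrow> complex \<Rightarrow> complex \<Rightarrow> complex \<Rightarrow> complex option \<Rightarrow> complex option" where
  "moebius_map a b c d p =
     (case p of
        None \<Rightarrow> if c = 0 then None else Some (a / c)
      | Some z \<Rightarrow> if c * z + d = 0 then None else Some ((a * z + b) / (c * z + d)))"

definition linear_fractional :: "(complex option \<Rightarrow> complex option) \<Rightarrow> bool" where
  "linear_fractional F \<longleftrightarrow> (\<exists>a b c d. a * d - b * c \<noteq> 0 \<and> F = moebius_map a b c d)"

text \<open>A linear-fractional self-map of the disc is represented by a function of which only the
  values on the disc matter; its values at other points, such as boundary fixed points, are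
  always taken from the linear-fractional map of the sphere that extends it. There is at most
  one such map.\<close>

definition sphere_extension :: "(complex \<Rightarrow> complex) \<Rightarrow> (complex option \<Rightarrow> complex option) \<Rightarrow> bool" where
  "sphere_extension \<phi> F \<longleftrightarrow> linear_fractional F \<and> (\<forall>z\<in>unit_disc. F (Some z) = Some (\<phi> z))"

definition linear_fractional_self_map :: "(complex \<Rightarrow> complex) \<Rightarrow> bool" where
  "linear_fractional_self_map \<phi> \<longleftrightarrow> \<phi> ` unit_disc \<subseteq> unit_disc \<and> (\<exists>F. sphere_extension \<phi> F)"

definition sphere_fixed_point :: "(complex \<Rightarrow> complex) \<Rightarrow> complex option \<Rightarrow> bool" where
  "sphere_fixed_point \<phi> p \<longleftrightarrow> (\<exists>F. sphere_extension \<phi> F \<and> F p = p)"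

definition hyperbolic_self_map :: "(complex \<Rightarrow> complex) \<Rightarrow> bool" where
  "hyperbolic_self_map \<phi> \<longleftrightarrow>
     linear_fractional_self_map \<phi> \<and>
     (\<exists>z\<in>unit_disc. \<phi> z \<noteq> z) \<and>
     (\<exists>\<zeta>\<in>sphere 0 1. sphere_fixed_point \<phi> (Some \<zeta>) \<and>
        (\<exists>p. p \<noteq> Some \<zeta> \<and> sphere_fixed_point \<phi> p))"

definition disc_automorphism :: "(complex \<Rightarrow> complex) \<Rightarrow> bool" where
  "disc_automorphism \<phi> \<longleftrightarrow> \<phi> holomorphic_on unit_disc \<and> bij_betw \<phi> unit_disc unit_disc"

end

theory Submission
  imports Defs
begin

text \<open>The finite fixed points of \<open>\<phi>\<close> are the roots of \<open>a0 z\<^sup>2 + (a1 - a0\<^sup>2 - 1) z + a0\<close>, whose product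
  is 1 when \<open>a0 \<noteq> 0\<close>; hence both fixed points lie on the unit circle. On that circle
  \<open>\<bar>c z + d\<bar>\<^sup>2 - \<bar>a z + b\<bar>\<^sup>2\<close> has the form \<open>P + 2 Re (Q z)\<close>; it is nonnegative for a self-map
  \<open>z \<mapsto> (a z + b) / (c z + d)\<close> of the disc, and if it has two zeros it vanishes identically. Then
  \<open>\<bar>c z + d\<bar>\<^sup>2 - \<bar>a z + b\<bar>\<^sup>2\<close> is a positive multiple of \<open>1 - \<bar>z\<bar>\<^sup>2\<close>, so that the inverse map also
  preserves the disc.\<close>

lemma cmod_linear_diff:
  fixes a b c d z :: complex
  shows "(cmod (c * z + d))\<^sup>2 - (cmod (a * z + b))\<^sup>2 =
    ((cmod c)\<^sup>2 - (cmod a)\<^sup>2) * (cmod z)\<^sup>2 + ((cmod d)\<^sup>2 - (cmod b)\<^sup>2)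
      + 2 * Re ((c * cnj d - a * cnj b) * z)"
  by (simp add: cmod_power2, simp add: power2_eq_square algebra_simps)

text \<open>If \<open>Q\<close> is nonzero, the minimum on the circle is
  \<open>P - 2 * cmod Q\<close>, attained at a single point; so a nonnegative function of this form
  has at most one zero.\<close>

lemma nonneg_on_circle_two_zeros:
  fixes Q \<zeta> \<eta> :: complex and P :: real
  assumes nonneg: "\<And>z. cmod z = 1 \<Longrightarrow> 0 \<le> P + 2 * Re (Q * z)"
    and \<zeta>: "cmod \<zeta> = 1" "P + 2 * Re (Q * \<zeta>) = 0"
    and \<eta>: "cmod \<eta> = 1" "P + 2 * Re (Q * \<eta>) = 0"
    and "\<zeta> \<noteq> \<eta>"
  shows "P = 0 \<and> Q = 0"
proof -
  have "Q = 0"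
  proof (rule ccontr)
    assume Q: "Q \<noteq> 0"
    \<comment> \<open>The minimizer: the unit number that turns \<open>Q\<close> to the negative
      real axis.\<close>
    have "0 \<le> P + 2 * Re (Q * (- cnj Q / cmod Q))"
      using Q by (intro nonneg) (simp add: norm_divide)
    also have "Q * (- cnj Q / cmod Q) = - of_real (cmod Q)"
      using Q by (simp add: complex_norm_square[symmetric] power2_eq_square)
    finally have P: "2 * cmod Q \<le> P"
      by simp
    \<comment> \<open>At a zero the real part of \<open>Q * z\<close> is at most minus its modulus,
      which leaves one value.\<close>
    have *: "Q * z = - of_real (cmod Q)" if "cmod z = 1" "P + 2 * Re (Q * z) = 0" for z
    proof -
      have n: "cmod (Q * z) = cmod Q"
        using that by (simp add: norm_mult)
      have "Re (Q * z) \<le> - cmod Q"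
        using that P by linarith
      moreover have "\<bar>Re (Q * z)\<bar> \<le> cmod Q"
        using abs_Re_le_cmod[of "Q * z"] n by simp
      ultimately have re: "Re (Q * z) = - cmod Q"
        by linarith
      then have "Im (Q * z) = 0"
        using cmod_power2[of "Q * z"] n by simp
      then show ?thesis
        using re by (simp add: complex_eq_iff)
    qed
    have "Q * \<zeta> = Q * \<eta>"
      using *[OF \<zeta>] *[OF \<eta>] by simp
    then show False
      using Q \<open>\<zeta> \<noteq> \<eta>\<close> by simp
  qed
  then show ?thesis
    using \<zeta>(2) by simp
qed

text \<open>Contact with the circle is stated by moduli of numerator and denominator, since
  \<open>den\<close> says nothing about poles on the circle.\<close>

lemma disc_automorphism_if_two_boundary_contacts:
  fixes a b c d \<zeta> \<eta> :: complex and \<phi> :: "complex \<Rightarrow> complex"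
  assumes det: "a * d - b * c \<noteq> 0"
    and den: "\<And>z. z \<in> unit_disc \<Longrightarrow> c * z + d \<noteq> 0"
    and \<phi>: "\<And>z. z \<in> unit_disc \<Longrightarrow> \<phi> z = (a * z + b) / (c * z + d)"
    and self: "\<phi> ` unit_disc \<subseteq> unit_disc"
    and \<zeta>: "cmod \<zeta> = 1" "cmod (a * \<zeta> + b) = cmod (c * \<zeta> + d)"
    and \<eta>: "cmod \<eta> = 1" "cmod (a * \<eta> + b) = cmod (c * \<eta> + d)"
    and "\<zeta> \<noteq> \<eta>"
  shows "disc_automorphism \<phi>"
proof -
  define h where "h = (\<lambda>z. (cmod (c * z + d))\<^sup>2 - (cmod (a * z + b))\<^sup>2)"
  define P where "P = (cmod c)\<^sup>2 - (cmod a)\<^sup>2 + ((cmod d)\<^sup>2 - (cmod b)\<^sup>2)"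
  define Q where "Q = c * cnj d - a * cnj b"
  define s where "s = (cmod d)\<^sup>2 - (cmod b)\<^sup>2"
  have h_pos: "0 < h z" if "z \<in> unit_disc" for z
  proof -
    have "cmod ((a * z + b) / (c * z + d)) < 1"
      using self \<phi>[OF that] that by force
    then have "cmod (a * z + b) < cmod (c * z + d)"
      using den[OF that] by (simp add: norm_divide)
    then show ?thesis
      by (simp add: h_def power_strict_mono)
  qed
  have h_circle: "h z = P + 2 * Re (Q * z)" if "cmod z = 1" for z
    unfolding h_def P_def Q_def cmod_linear_diff using that by simp
  have h_nonneg: "0 \<le> h z" if "cmod z = 1" for z
  proof (rule continuous_ge_on_closure[of unit_disc h])
    show "continuous_on (closure unit_disc) h"
      unfolding h_def by (intro continuous_intros)
    show "z \<in> closure unit_disc"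
      using that by simp
    show "0 \<le> h w" if "w \<in> unit_disc" for w
      using h_pos[OF that] by simp
  qed
  have PQ: "P = 0 \<and> Q = 0"
  proof (rule nonneg_on_circle_two_zeros)
    show "0 \<le> P + 2 * Re (Q * z)" if "cmod z = 1" for z
      using h_nonneg h_circle that by simp
    show "P + 2 * Re (Q * \<zeta>) = 0" "P + 2 * Re (Q * \<eta>) = 0"
      using h_circle[OF \<zeta>(1)] h_circle[OF \<eta>(1)] \<zeta>(2) \<eta>(2) by (simp_all add: h_def)
  qed (use \<zeta> \<eta> \<open>\<zeta> \<noteq> \<eta>\<close> in auto)
  then have ca: "(cmod c)\<^sup>2 - (cmod a)\<^sup>2 = - s"
    by (simp add: P_def s_def)
  have h_eq: "h z = s * (1 - (cmod z)\<^sup>2)" for z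
    using PQ unfolding h_def cmod_linear_diff ca Q_def s_def[symmetric]
    by (simp add: algebra_simps)
  have s: "0 < s"
    using h_pos[of 0] h_eq[of 0] by simp
  have "inj_on \<phi> unit_disc"
  proof (rule inj_onI)
    fix z w
    assume zw: "z \<in> unit_disc" "w \<in> unit_disc" "\<phi> z = \<phi> w"
    then have "(a * z + b) * (c * w + d) = (a * w + b) * (c * z + d)"
      using den[OF zw(1)] den[OF zw(2)] by (simp add: \<phi> frac_eq_eq)
    then have "(a * d - b * c) * (z - w) = 0"
      by algebra
    then show "z = w"
      using det by simp
  qed
  moreover have "w \<in> \<phi> ` unit_disc" if w: "w \<in> unit_disc" for w
  proof -
    \<comment> \<open>This keeps the pole of the inverse map off the disc.\<close>
    have "cmod c < cmod a"
      by (rule power2_less_imp_less) (use ca s in linarith, simp)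
    moreover have "cmod (c * w) \<le> cmod c"
      using w by (simp add: norm_mult mult_left_le)
    ultimately have "a \<noteq> c * w"
      by fastforce
    then have nz: "a - c * w \<noteq> 0"
      by simp
    \<comment> \<open>The inverse map at \<open>w\<close>. It lands in the disc because the sign of
      \<open>h z\<close> is that of \<open>1 - (cmod z)\<^sup>2\<close>.\<close>
    define z where "z = (d * w - b) / (a - c * w)"
    have den_z: "c * z + d = (a * d - b * c) / (a - c * w)"
      using nz by (simp add: z_def field_simps)
    have num_z: "a * z + b = w * (c * z + d)"
      using nz unfolding den_z by (simp add: z_def field_simps)
    have nz': "c * z + d \<noteq> 0"
      using nz det by (simp add: den_z)
    have "cmod (a * z + b) < cmod (c * z + d)"
      using w nz' by (simp add: num_z norm_mult)
    then have "0 < h z"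
      by (simp add: h_def power_strict_mono)
    then have "(cmod z)\<^sup>2 < 1\<^sup>2"
      using s by (simp add: h_eq zero_less_mult_iff)
    then have z: "z \<in> unit_disc"
      using power2_less_imp_less[of "cmod z" 1] by simp
    then have "\<phi> z = w"
      using nz' by (simp add: \<phi> num_z)
    with z show ?thesis
      by blast
  qed
  ultimately have "bij_betw \<phi> unit_disc unit_disc"
    using self by (auto simp: bij_betw_def)
  moreover have "(\<lambda>z. (a * z + b) / (c * z + d)) holomorphic_on unit_disc"
    using den by (intro holomorphic_intros) auto
  then have "\<phi> holomorphic_on unit_disc"
    by (rule holomorphic_transform) (simp add: \<phi>)
  ultimately show ?thesis
    by (simp add: disc_automorphism_def)
qed

text \<open>Fixed points are defined through some unknown extension. Two fractions that agree on the
  disc have equal cross products as polynomials, so the fixed-point equation transfers to the given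
  coefficients.\<close>

lemma sphere_fixed_point_cases:
  fixes A B C D :: complex
  assumes fixed: "sphere_fixed_point \<phi> p"
    and den: "\<And>z. z \<in> unit_disc \<Longrightarrow> C * z + D \<noteq> 0"
    and \<phi>: "\<And>z. z \<in> unit_disc \<Longrightarrow> \<phi> z = (A * z + B) / (C * z + D)"
  shows "case p of None \<Rightarrow> C = 0 | Some z \<Rightarrow> A * z + B = z * (C * z + D)"
proof -
  obtain a b c d where det: "a * d - b * c \<noteq> 0"
    and ext: "\<And>z. z \<in> unit_disc \<Longrightarrow> moebius_map a b c d (Some z) = Some (\<phi> z)"
    and fp: "moebius_map a b c d p = p"
    using fixed by (auto simp: sphere_fixed_point_def sphere_extension_def linear_fractional_def)
  have cross: "(a * z + b) * (C * z + D) = (A * z + B) * (c * z + d)" if "z \<in> unit_disc" for z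
    using ext[OF that] den[OF that]
    by (auto simp: \<phi>[OF that] moebius_map_def frac_eq_eq split: if_splits)
  \<comment> \<open>A quadratic identity that holds at the three points 0, 1/2 and -1/2 holds coefficientwise.\<close>
  have c0: "b * D = B * d"
    using cross[of 0] by simp
  have plus: "(a + 2 * b) * (C + 2 * D) = (A + 2 * B) * (c + 2 * d)"
    using arg_cong[OF cross[of "1/2"], of "(*) 4"] by (simp add: algebra_simps)
  have minus: "(2 * b - a) * (2 * D - C) = (2 * B - A) * (2 * d - c)"
    using arg_cong[OF cross[of "-1/2"], of "(*) 4"] by (simp add: algebra_simps)
  have "2 * (a * C) + 8 * (b * D) = 2 * (A * c) + 8 * (B * d)"
    using arg_cong2[OF plus minus, of "(+)"] by (simp add: algebra_simps)
  then have c2: "a * C = A * c"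
    by (simp add: c0)
  have "4 * (a * D + b * C) = 4 * (A * d + B * c)"
    using arg_cong2[OF plus minus, of "(-)"] by (simp add: algebra_simps)
  then have c1: "a * D + b * C = A * d + B * c"
    by (simp only: mult_cancel_left) simp
  show ?thesis
  proof (cases p)
    case None
    then have "c = 0"
      using fp by (auto simp: moebius_map_def split: if_splits)
    then show ?thesis
      using None c2 det by auto
  next
    case (Some z)
    then have nz: "c * z + d \<noteq> 0" and "(a * z + b) / (c * z + d) = z"
      using fp by (auto simp: moebius_map_def split: if_splits)
    then have num: "a * z + b = z * (c * z + d)"
      by (simp add: field_simps)
    \<comment> \<open>The fixed point may lie outside the disc, where \<open>cross\<close> is
      silent; the coefficient identities still apply there.\<close>
    have "(c * z + d) * (A * z + B) = (a * z + b) * (C * z + D)"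
    proof -
      have "(c * z + d) * (A * z + B) = (A * c) * z\<^sup>2 + (A * d + B * c) * z + B * d"
        by algebra
      also have "\<dots> = (a * C) * z\<^sup>2 + (a * D + b * C) * z + b * D"
        by (simp add: c0 c1 c2)
      also have "\<dots> = (a * z + b) * (C * z + D)"
        by algebra
      finally show ?thesis .
    qed
    also have "\<dots> = (c * z + d) * (z * (C * z + D))"
      by (simp add: num)
    finally show ?thesis
      using Some nz by simp
  qed
qed

theorem lemma3p1:
  fixes \<phi> :: "complex \<Rightarrow> complex" and \<zeta> a0 a1 :: complex
  assumes "hyperbolic_self_map \<phi>"
    and "\<zeta> \<in> sphere 0 1"
    and "sphere_fixed_point \<phi> (Some \<zeta>)"
    and "a0 \<in> unit_disc"
    and "\<forall>z\<in>unit_disc. \<phi> z = a0 + a1 * z / (1 - a0 * z)"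
  shows "disc_automorphism \<phi>"
proof -
  obtain \<xi> p where self: "\<phi> ` unit_disc \<subseteq> unit_disc"
    and nid: "\<exists>z\<in>unit_disc. \<phi> z \<noteq> z"
    and \<xi>: "cmod \<xi> = 1" "sphere_fixed_point \<phi> (Some \<xi>)"
    and p: "p \<noteq> Some \<xi>" "sphere_fixed_point \<phi> p"
    using assms(1) by (auto simp: hyperbolic_self_map_def linear_fractional_self_map_def)
  have den_cball: "- a0 * z + 1 \<noteq> 0" if "cmod z \<le> 1" for z
  proof
    assume "- a0 * z + 1 = 0"
    then have "a0 * z = 1"
      by algebra
    then have "cmod a0 * cmod z = 1"
      by (metis norm_mult norm_one)
    then show False
      using assms(4) that mult_left_le[of "cmod z" "cmod a0"] by simp
  qed
  then have den: "- a0 * z + 1 \<noteq> 0" if "z \<in> unit_disc" for z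
    using that by simp
  have \<phi>: "\<phi> z = ((a1 - a0\<^sup>2) * z + a0) / (- a0 * z + 1)" if "z \<in> unit_disc" for z
    using den[OF that] assms(5) that by (simp add: field_simps power2_eq_square)
  note fixed = sphere_fixed_point_cases[OF _ den \<phi>]
  have fix_\<xi>: "(a1 - a0\<^sup>2) * \<xi> + a0 = \<xi> * (- a0 * \<xi> + 1)"
    using fixed[OF \<xi>(2)] by simp
  \<comment> \<open>For \<open>a0 = 0\<close> the map is \<open>a1 * z\<close>, and fixing
    \<open>\<xi>\<close> would make it the identity. A nonzero \<open>a0\<close> also keeps infinity
    from being fixed.\<close>
  have a0: "a0 \<noteq> 0"
  proof
    assume "a0 = 0"
    moreover from this have "a1 = 1"
      using fix_\<xi> \<xi>(1) by auto
    ultimately show False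
      using nid assms(5) by simp
  qed
  then obtain \<eta> where \<eta>: "p = Some \<eta>"
    using fixed[OF p(2)] by (cases p) auto
  then have fix_\<eta>: "(a1 - a0\<^sup>2) * \<eta> + a0 = \<eta> * (- a0 * \<eta> + 1)"
    using fixed[OF p(2)] by simp
  have neq: "\<xi> \<noteq> \<eta>"
    using p(1) \<eta> by auto
  \<comment> \<open>Multiplying each equation by the other root and subtracting eliminates the
    linear coefficient.\<close>
  have "a0 * (\<xi> - \<eta>) * (\<xi> * \<eta> - 1) = 0"
    using fix_\<xi> fix_\<eta> by algebra
  then have "\<xi> * \<eta> = 1"
    using a0 neq by simp
  then have cmod_\<eta>: "cmod \<eta> = 1"
    using \<xi>(1) by (metis mult_1 norm_mult norm_one)
  \<comment> \<open>The determinant is \<open>a1\<close>. If it vanished, the map would be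
    constantly \<open>a0\<close> on the disc and \<open>\<xi>\<close> would be \<open>a0\<close> or
    a pole, neither of which lies on the circle.\<close>
  have "a1 \<noteq> 0"
  proof
    assume "a1 = 0"
    then have "(\<xi> - a0) * (- a0 * \<xi> + 1) = 0"
      using fix_\<xi> by algebra
    then show False
      using den_cball[of \<xi>] \<xi>(1) assms(4) by auto
  qed
  then have "(a1 - a0\<^sup>2) * 1 - a0 * (- a0) \<noteq> 0"
    by (simp add: power2_eq_square)
  then show ?thesis
  proof (rule disc_automorphism_if_two_boundary_contacts[OF _ den \<phi> self])
    show "cmod ((a1 - a0\<^sup>2) * \<xi> + a0) = cmod (- a0 * \<xi> + 1)"
      unfolding fix_\<xi> by (simp add: norm_mult \<xi>(1))
    show "cmod ((a1 - a0\<^sup>2) * \<eta> + a0) = cmod (- a0 * \<eta> + 1)"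
      unfolding fix_\<eta> by (simp add: norm_mult cmod_\<eta>)
  qed (use \<xi>(1) cmod_\<eta> neq in auto)
qed

end
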